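(* Let $g$ be an Einstein metric on a manifold of dimension $n\ge3$ with Levi-Civita connection $\nabla$. The projective tractor sub-metric $h^{AB}$ on the projective cotractor bundle $\mathcal{T}^*$ of $[\nabla]$ determined by $g$ is the pullback, under the inclusion $\iota:\mathcal{T}^*\to\widetilde{\mathcal{T}}^*$, of the conformal tractor metric $\widetilde h^{\alpha\beta}$ of $[g]$. That is, $h^{AB}=\iota_\alpha{}^A\iota_\beta{}^B\widetilde h^{\alpha\beta}$.
   Context: Metrics are pseudo-Riemannian; Einstein means $\mathrm{Ric}_{ab}$ is a constant multiple of $g_{ab}$, where $(\nabla_a\nabla_b-\nabla_b\nabla_a)v^c=R_{ab}{}^c{}_dv^d$, $\mathrm{Ric}_{ab}=R_{ca}{}^c{}_b$. Projective Schouten tensor of the Levi-Civita connection: $P_{ab}=\frac1{n-1}\mathrm{Ric}_{ab}$. Conformal Schouten tensor $\widetilde P_{ab}$: $\mathrm{Ric}_{ab}=(n-2)\widetilde P_{ab}+\widetilde Jg_{ab}$, $\widetilde J=g^{ab}\widetilde P_{ab}$. All density bundles are trivialised using $g$. Projective cotractor bundle: $\mathcal{T}^*=J^1\mathcal{E}(1)$ ($\mathcal{E}(1)$ the positive $(2n+2)$-th root of $(\Lambda^nTM)^2$), identified in the splitting given by $\nabla$ with $T^*M\oplus\mathbb{R}$, sections written $U_A=(\mu_a\mid\sigma)$. The projective tractor sub-metric determined by the Einstein metric $g$, with $P_{ab}=\lambda g_{ab}$, is $h^{AB}U_A\underline U_B=g^{ab}\mu_a\underline\mu_b+\lambda\sigma\underline\sigma$.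 Conformal cotractor bundle: $\widetilde{\mathcal{T}}^*$ is the quotient of $J^2(\mathcal{E}[1])$ ($\mathcal{E}[1]$ the positive $2n$-th root of $(\Lambda^nTM)^2$) by the trace-free symmetric 2-tensors of weight 1, identified in the splitting given by $g$ with $\mathbb{R}\oplus T^*M\oplus\mathbb{R}$, sections written $V_\alpha=(\tau\mid\mu_a\mid\sigma)$. The conformal tractor metric is $\widetilde h^{\alpha\beta}V_\alpha\underline V_\beta=g^{ab}\mu_a\underline\mu_b+\sigma\underline\tau+\tau\underline\sigma$. The inclusion is $\iota_\alpha{}^AU_A=(\frac1n\widetilde J\sigma\mid\mu_a\mid\sigma)$ for $U_A=(\mu_a\mid\sigma)$. *)

theory Defs
  imports "HOL-Analysis.Analysis"
begin

section \<open>Smooth functions and smooth manifolds\<close>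

text \<open>Only used for open \<open>S\<close>, where the derivative within \<open>S\<close> is the derivative.\<close>

primrec Ck_on :: "nat \<Rightarrow> ('a::real_normed_vector \<Rightarrow> 'b::real_normed_vector) \<Rightarrow> 'a set \<Rightarrow> bool" where
  "Ck_on 0 f S = continuous_on S f"
| "Ck_on (Suc k) f S =
     (f differentiable_on S \<and> (\<forall>v. Ck_on k (\<lambda>x. frechet_derivative f (at x) v) S))"

definition smooth_on :: "('a::real_normed_vector \<Rightarrow> 'b::real_normed_vector) \<Rightarrow> 'a set \<Rightarrow> bool" where
  "smooth_on f S \<longleftrightarrow> (\<forall>k. Ck_on k f S)"

definition pd :: "'n \<Rightarrow> (real^'n \<Rightarrow> real) \<Rightarrow> real^'n \<Rightarrow> real" where
  "pd i f x = frechet_derivative f (at x) (axis i 1)"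

text \<open>A chart is a pair of an open domain and a coordinate map; the values of the coordinate map
  outside the domain are irrelevant.  The manifold is the whole type \<open>'m\<close>, of dimension
  \<open>CARD('n)\<close>; the atlas is not required to be maximal.\<close>

type_synonym ('m, 'n) chart = "'m set \<times> ('m \<Rightarrow> real^'n)"

definition cdom :: "('m, 'n::finite) chart \<Rightarrow> 'm set" where
  "cdom c = fst c"

definition coord :: "('m, 'n::finite) chart \<Rightarrow> 'm \<Rightarrow> real^'n" where
  "coord c = snd c"

definition cimg :: "('m, 'n::finite) chart \<Rightarrow> (real^'n) set" where
  "cimg c = coord c ` cdom c"

definition param :: "('m, 'n::finite) chart \<Rightarrow> real^'n \<Rightarrow> 'm" where
  "param c = inv_into (cdom c) (coord c)"

definition overlap :: "('m, 'n::finite) chart \<Rightarrow> ('m, 'n) chart \<Rightarrow> (real^'n) set" where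
  "overlap c d = coord c ` (cdom c \<inter> cdom d)"

definition transition :: "('m, 'n::finite) chart \<Rightarrow> ('m, 'n) chart \<Rightarrow> real^'n \<Rightarrow> real^'n" where
  "transition c d = coord d \<circ> param c"

definition smooth_atlas :: "('m::topological_space, 'n::finite) chart set \<Rightarrow> bool" where
  "smooth_atlas A \<longleftrightarrow>
     (\<Union>c\<in>A. cdom c) = UNIV \<and>
     (\<forall>c\<in>A. open (cdom c) \<and> open (cimg c) \<and>
        homeomorphism (cdom c) (cimg c) (coord c) (param c)) \<and>
     (\<forall>c\<in>A. \<forall>d\<in>A. smooth_on (transition c d) (overlap c d))"

text \<open>\<open>jacobian c d x $ i $ j\<close> is the derivative of the \<open>i\<close>-th \<open>d\<close>-coordinate with respect to the
  \<open>j\<close>-th \<open>c\<close>-coordinate.\<close>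

definition jacobian :: "('m, 'n::finite) chart \<Rightarrow> ('m, 'n) chart \<Rightarrow> real^'n \<Rightarrow> real^'n^'n" where
  "jacobian c d x = matrix (frechet_derivative (transition c d) (at x))"


section \<open>Metric and Levi-Civita connection\<close>

text \<open>Tensor fields are given by their components in every chart, as functions on the coordinate
  domain, together with the transformation law.\<close>

definition pseudo_riemannian_metric ::
  "('m, 'n::finite) chart set \<Rightarrow> (('m, 'n) chart \<Rightarrow> real^'n \<Rightarrow> real^'n^'n) \<Rightarrow> bool" where
  "pseudo_riemannian_metric A g \<longleftrightarrow>
     (\<forall>c\<in>A. smooth_on (g c) (cimg c) \<and>
        (\<forall>x\<in>cimg c. transpose (g c x) = g c x \<and> invertible (g c x))) \<and>
     (\<forall>c\<in>A. \<forall>d\<in>A. \<forall>x\<in>overlap c d.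
        g c x = transpose (jacobian c d x) ** g d (transition c d x) ** jacobian c d x)"

text \<open>The contraction \<open>g\<^sup>a\<^sup>b T\<^sub>a\<^sub>b\<close>.\<close>

definition gtrace :: "real^'n^'n \<Rightarrow> real^'n^'n \<Rightarrow> real" where
  "gtrace G T = (\<Sum>a\<in>UNIV. \<Sum>b\<in>UNIV. matrix_inv G $ a $ b * T $ a $ b)"

text \<open>\<open>\<Gamma> c x $ k $ i $ j\<close> is the connection coefficient with upper index \<open>k\<close>, so that
  \<open>\<nabla>\<^sub>i v\<^sup>k = \<partial>\<^sub>i v\<^sup>k + \<Gamma>\<^sup>k\<^sub>i\<^sub>j v\<^sup>j\<close>.\<close>

definition affine_connection ::
  "('m, 'n::finite) chart set \<Rightarrow> (('m, 'n) chart \<Rightarrow> real^'n \<Rightarrow> real^'n^'n^'n) \<Rightarrow> bool" where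
  "affine_connection A \<Gamma> \<longleftrightarrow>
     (\<forall>c\<in>A. smooth_on (\<Gamma> c) (cimg c)) \<and>
     (\<forall>c\<in>A. \<forall>d\<in>A. \<forall>x\<in>overlap c d. \<forall>i j k.
        (\<Sum>m\<in>UNIV. jacobian c d x $ k $ m * \<Gamma> c x $ m $ i $ j) =
        pd i (\<lambda>y. jacobian c d y $ k $ j) x +
        (\<Sum>l\<in>UNIV. \<Sum>m\<in>UNIV. \<Gamma> d (transition c d x) $ k $ l $ m *
            jacobian c d x $ l $ i * jacobian c d x $ m $ j))"

definition levi_civita ::
  "('m, 'n::finite) chart set \<Rightarrow> (('m, 'n) chart \<Rightarrow> real^'n \<Rightarrow> real^'n^'n) \<Rightarrow>
   (('m, 'n) chart \<Rightarrow> real^'n \<Rightarrow> real^'n^'n^'n) \<Rightarrow> bool" where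
  "levi_civita A g \<Gamma> \<longleftrightarrow>
     affine_connection A \<Gamma> \<and>
     (\<forall>c\<in>A. \<forall>x\<in>cimg c. \<forall>i j k. \<Gamma> c x $ k $ i $ j = \<Gamma> c x $ k $ j $ i) \<and>
     (\<forall>c\<in>A. \<forall>x\<in>cimg c. \<forall>i j k.
        pd i (\<lambda>y. g c y $ j $ k) x
          - (\<Sum>l\<in>UNIV. \<Gamma> c x $ l $ i $ j * g c x $ l $ k)
          - (\<Sum>l\<in>UNIV. \<Gamma> c x $ l $ i $ k * g c x $ j $ l) = 0)"


section \<open>Curvature\<close>

text \<open>In this section \<open>\<Gamma>\<close> and \<open>v\<close> are components in one fixed chart:
  \<open>nabla_vec \<Gamma> v x b c\<close> is \<open>\<nabla>\<^sub>b v\<^sup>c\<close> and \<open>nabla2_vec \<Gamma> v x a b c\<close> is \<open>\<nabla>\<^sub>a \<nabla>\<^sub>b v\<^sup>c\<close>.\<close>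

definition nabla_vec ::
  "(real^'n \<Rightarrow> real^'n^'n^'n) \<Rightarrow> (real^'n \<Rightarrow> real^'n) \<Rightarrow> real^'n \<Rightarrow> 'n \<Rightarrow> 'n \<Rightarrow> real" where
  "nabla_vec \<Gamma> v x b c = pd b (\<lambda>y. v y $ c) x + (\<Sum>e\<in>UNIV. \<Gamma> x $ c $ b $ e * v x $ e)"

definition nabla2_vec ::
  "(real^'n \<Rightarrow> real^'n^'n^'n) \<Rightarrow> (real^'n \<Rightarrow> real^'n) \<Rightarrow> real^'n \<Rightarrow> 'n \<Rightarrow> 'n \<Rightarrow> 'n \<Rightarrow> real" where
  "nabla2_vec \<Gamma> v x a b c = pd a (\<lambda>y. nabla_vec \<Gamma> v y b c) x
     + (\<Sum>e\<in>UNIV. \<Gamma> x $ c $ a $ e * nabla_vec \<Gamma> v x b e)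
     - (\<Sum>e\<in>UNIV. \<Gamma> x $ e $ a $ b * nabla_vec \<Gamma> v x e c)"

text \<open>\<open>curvature S \<Gamma> x $ a $ b $ c $ d\<close> is \<open>R\<^sub>a\<^sub>b\<^sup>c\<^sub>d\<close>: the tensor determined by
  \<open>(\<nabla>\<^sub>a \<nabla>\<^sub>b - \<nabla>\<^sub>b \<nabla>\<^sub>a) v\<^sup>c = R\<^sub>a\<^sub>b\<^sup>c\<^sub>d v\<^sup>d\<close> for all smooth vector fields \<open>v\<close> on the coordinate
  domain \<open>S\<close>.\<close>

definition curvature ::
  "(real^'n) set \<Rightarrow> (real^'n \<Rightarrow> real^'n^'n^'n) \<Rightarrow> real^'n \<Rightarrow> real^'n^'n^'n^'n" where
  "curvature S \<Gamma> x = (THE R. \<forall>v. smooth_on v S \<longrightarrow>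
     (\<forall>a b c. nabla2_vec \<Gamma> v x a b c - nabla2_vec \<Gamma> v x b a c =
        (\<Sum>d\<in>UNIV. R $ a $ b $ c $ d * v x $ d)))"

definition ricci ::
  "(('m, 'n::finite) chart \<Rightarrow> real^'n \<Rightarrow> real^'n^'n^'n) \<Rightarrow> ('m, 'n) chart \<Rightarrow> real^'n \<Rightarrow> real^'n^'n" where
  "ricci \<Gamma> c x = (\<chi> a b. \<Sum>e\<in>UNIV. curvature (cimg c) (\<Gamma> c) x $ e $ a $ e $ b)"

definition einstein ::
  "('m, 'n::finite) chart set \<Rightarrow> (('m, 'n) chart \<Rightarrow> real^'n \<Rightarrow> real^'n^'n) \<Rightarrow>
   (('m, 'n) chart \<Rightarrow> real^'n \<Rightarrow> real^'n^'n^'n) \<Rightarrow> bool" where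
  "einstein A g \<Gamma> \<longleftrightarrow> (\<exists>\<kappa>::real. \<forall>c\<in>A. \<forall>x\<in>cimg c. ricci \<Gamma> c x = \<kappa> *\<^sub>R g c x)"

definition proj_schouten ::
  "(('m, 'n::finite) chart \<Rightarrow> real^'n \<Rightarrow> real^'n^'n^'n) \<Rightarrow> ('m, 'n) chart \<Rightarrow> real^'n \<Rightarrow> real^'n^'n" where
  "proj_schouten \<Gamma> c x = (1 / (real CARD('n) - 1)) *\<^sub>R ricci \<Gamma> c x"

definition conf_schouten ::
  "(('m, 'n::finite) chart \<Rightarrow> real^'n \<Rightarrow> real^'n^'n) \<Rightarrow>
   (('m, 'n) chart \<Rightarrow> real^'n \<Rightarrow> real^'n^'n^'n) \<Rightarrow> ('m, 'n) chart \<Rightarrow> real^'n \<Rightarrow> real^'n^'n" where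
  "conf_schouten g \<Gamma> c x = (THE P. ricci \<Gamma> c x =
      (real CARD('n) - 2) *\<^sub>R P + gtrace (g c x) P *\<^sub>R g c x)"

definition conf_J ::
  "(('m, 'n::finite) chart \<Rightarrow> real^'n \<Rightarrow> real^'n^'n) \<Rightarrow>
   (('m, 'n) chart \<Rightarrow> real^'n \<Rightarrow> real^'n^'n^'n) \<Rightarrow> ('m, 'n) chart \<Rightarrow> real^'n \<Rightarrow> real" where
  "conf_J g \<Gamma> c x = gtrace (g c x) (conf_schouten g \<Gamma> c x)"


section \<open>Densities and jets\<close>

text \<open>Local sections near \<open>p\<close> of the positive \<open>k\<close>-th root of \<open>(\<Lambda>\<^sup>n TM)\<^sup>2\<close>, given by their components
  in every chart.  The component of a section of \<open>\<Lambda>\<^sup>n TM\<close> is multiplied by the Jacobian determinant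
  under a change of chart, whence the factor below.\<close>

type_synonym ('m, 'n) density = "('m, 'n) chart \<Rightarrow> real^'n \<Rightarrow> real"

definition densities ::
  "('m::topological_space, 'n::finite) chart set \<Rightarrow> nat \<Rightarrow> 'm \<Rightarrow> ('m, 'n) density set" where
  "densities A k p = {s. \<exists>W. open W \<and> p \<in> W \<and>
     (\<forall>c\<in>A. smooth_on (s c) (coord c ` (cdom c \<inter> W))) \<and>
     (\<forall>c\<in>A. \<forall>d\<in>A. \<forall>q \<in> cdom c \<inter> cdom d \<inter> W.
        s d (coord d q) = root k ((det (jacobian c d (coord c q)))\<^sup>2) * s c (coord c q))}"

definition jet1_eq ::
  "('m, 'n::finite) chart set \<Rightarrow> 'm \<Rightarrow> ('m, 'n) density \<Rightarrow> ('m, 'n) density \<Rightarrow> bool" where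
  "jet1_eq A p s t \<longleftrightarrow> (\<forall>c\<in>A. p \<in> cdom c \<longrightarrow>
     s c (coord c p) = t c (coord c p) \<and>
     (\<forall>i. pd i (s c) (coord c p) = pd i (t c) (coord c p)))"

definition jet2_eq ::
  "('m, 'n::finite) chart set \<Rightarrow> 'm \<Rightarrow> ('m, 'n) density \<Rightarrow> ('m, 'n) density \<Rightarrow> bool" where
  "jet2_eq A p s t \<longleftrightarrow> jet1_eq A p s t \<and> (\<forall>c\<in>A. p \<in> cdom c \<longrightarrow>
     (\<forall>i j. pd i (pd j (s c)) (coord c p) = pd i (pd j (t c)) (coord c p)))"

text \<open>The fibres at \<open>p\<close> of the first and second jet bundles of the density bundle with parameter \<open>k\<close>.\<close>

definition jets1 ::
  "('m::topological_space, 'n::finite) chart set \<Rightarrow> nat \<Rightarrow> 'm \<Rightarrow> ('m, 'n) density set set" where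
  "jets1 A k p = densities A k p //
     {(s, t). s \<in> densities A k p \<and> t \<in> densities A k p \<and> jet1_eq A p s t}"

definition jets2 ::
  "('m::topological_space, 'n::finite) chart set \<Rightarrow> nat \<Rightarrow> 'm \<Rightarrow> ('m, 'n) density set set" where
  "jets2 A k p = densities A k p //
     {(s, t). s \<in> densities A k p \<and> t \<in> densities A k p \<and> jet2_eq A p s t}"

text \<open>The trivialisation by \<open>g\<close>: the component of a density is divided by that of the positive density
  determined by \<open>g\<close>, which is the \<open>k\<close>-th root of \<open>\<bar>det g\<bar>\<^sup>-\<^sup>1\<close> because \<open>\<bar>det g\<bar>\<^sup>-\<^sup>1\<close> is the component
  of a section of \<open>(\<Lambda>\<^sup>n TM)\<^sup>2\<close>.\<close>

definition trivialise ::
  "nat \<Rightarrow> (('m, 'n::finite) chart \<Rightarrow> real^'n \<Rightarrow> real^'n^'n) \<Rightarrow> ('m, 'n) density \<Rightarrow>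
   ('m, 'n) chart \<Rightarrow> real^'n \<Rightarrow> real" where
  "trivialise k g s c x = s c x / root k (1 / \<bar>det (g c x)\<bar>)"


section \<open>Projective cotractors\<close>

definition proj_cotractors ::
  "('m::topological_space, 'n::finite) chart set \<Rightarrow> 'm \<Rightarrow> ('m, 'n) density set set" where
  "proj_cotractors A p = jets1 A (2 * CARD('n) + 2) p"

text \<open>The splitting given by \<open>\<nabla>\<close>, sending the jet of \<open>\<sigma>\<close> to \<open>(\<nabla>\<^sub>a \<sigma> | \<sigma>)\<close>, with the covector in
  components in the chart \<open>c\<close>.  Since \<open>\<nabla>\<close> preserves \<open>g\<close>, it acts on densities trivialised by \<open>g\<close> as
  the exterior derivative on functions.\<close>

definition proj_split ::
  "(('m, 'n::finite) chart \<Rightarrow> real^'n \<Rightarrow> real^'n^'n) \<Rightarrow> ('m, 'n) chart \<Rightarrow> 'm \<Rightarrow>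
   ('m, 'n) density set \<Rightarrow> (real^'n) \<times> real" where
  "proj_split g c p U =
     (let \<sigma> = trivialise (2 * CARD('n) + 2) g (SOME s. s \<in> U) c; x = coord c p
      in ((\<chi> a. pd a \<sigma> x), \<sigma> x))"

definition proj_tractor_metric ::
  "(('m, 'n::finite) chart \<Rightarrow> real^'n \<Rightarrow> real^'n^'n) \<Rightarrow> real \<Rightarrow> ('m, 'n) chart \<Rightarrow> 'm \<Rightarrow>
   ('m, 'n) density set \<Rightarrow> ('m, 'n) density set \<Rightarrow> real" where
  "proj_tractor_metric g lam c p U U' =
     (let (\<mu>, \<sigma>) = proj_split g c p U; (\<mu>', \<sigma>') = proj_split g c p U'
      in gtrace (g c (coord c p)) (\<chi> a b. \<mu> $ a * \<mu>' $ b) + lam * \<sigma> * \<sigma>')"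


section \<open>Conformal cotractors\<close>

text \<open>The trace-free symmetric 2-tensors of weight 1 are included in the second jets as those jets whose
  underlying first jet vanishes and whose second derivatives are trace-free; two jets are identified
  if their difference is of this form.\<close>

definition conf_cotractors ::
  "('m::topological_space, 'n::finite) chart set \<Rightarrow> (('m, 'n) chart \<Rightarrow> real^'n \<Rightarrow> real^'n^'n) \<Rightarrow> 'm \<Rightarrow>
   ('m, 'n) density set set set" where
  "conf_cotractors A g p = jets2 A (2 * CARD('n)) p //
     {(j, j'). j \<in> jets2 A (2 * CARD('n)) p \<and> j' \<in> jets2 A (2 * CARD('n)) p \<and>
        (\<exists>s\<in>j. \<exists>t\<in>j'. jet1_eq A p s t \<and>
          (\<forall>c\<in>A. p \<in> cdom c \<longrightarrow> gtrace (g c (coord c p))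
             (\<chi> a b. pd a (pd b (\<lambda>y. s c y - t c y)) (coord c p)) = 0))}"

text \<open>The splitting given by \<open>g\<close>, sending the class of the 2-jet of \<open>\<sigma>\<close> to
  \<open>(-1/n (g\<^sup>a\<^sup>b \<nabla>\<^sub>a \<nabla>\<^sub>b \<sigma> + J \<sigma>) | \<nabla>\<^sub>a \<sigma> | \<sigma>)\<close>, again with \<open>\<sigma>\<close> trivialised by \<open>g\<close> and covectors in
  components in the chart \<open>c\<close>.\<close>

definition conf_split ::
  "(('m, 'n::finite) chart \<Rightarrow> real^'n \<Rightarrow> real^'n^'n) \<Rightarrow>
   (('m, 'n) chart \<Rightarrow> real^'n \<Rightarrow> real^'n^'n^'n) \<Rightarrow> ('m, 'n) chart \<Rightarrow> 'm \<Rightarrow>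
   ('m, 'n) density set set \<Rightarrow> real \<times> (real^'n) \<times> real" where
  "conf_split g \<Gamma> c p V =
     (let \<sigma> = trivialise (2 * CARD('n)) g (SOME s. s \<in> \<Union>V) c; x = coord c p;
          \<Delta>\<sigma> = gtrace (g c x)
            (\<chi> a b. pd a (pd b \<sigma>) x - (\<Sum>e\<in>UNIV. \<Gamma> c x $ e $ a $ b * pd e \<sigma> x))
      in (- (\<Delta>\<sigma> + conf_J g \<Gamma> c x * \<sigma> x) / real CARD('n), (\<chi> a. pd a \<sigma> x), \<sigma> x))"

definition conf_tractor_metric ::
  "(('m, 'n::finite) chart \<Rightarrow> real^'n \<Rightarrow> real^'n^'n) \<Rightarrow>
   (('m, 'n) chart \<Rightarrow> real^'n \<Rightarrow> real^'n^'n^'n) \<Rightarrow> ('m, 'n) chart \<Rightarrow> 'm \<Rightarrow>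
   ('m, 'n) density set set \<Rightarrow> ('m, 'n) density set set \<Rightarrow> real" where
  "conf_tractor_metric g \<Gamma> c p V V' =
     (let (\<tau>, \<mu>, \<sigma>) = conf_split g \<Gamma> c p V; (\<tau>', \<mu>', \<sigma>') = conf_split g \<Gamma> c p V'
      in gtrace (g c (coord c p)) (\<chi> a b. \<mu> $ a * \<mu>' $ b) + \<sigma> * \<tau>' + \<tau> * \<sigma>')"


section \<open>The inclusion of projective into conformal cotractors\<close>

text \<open>The splitting is a bijection from the fibre of the conformal cotractor bundle, and \<open>inv_into\<close> is
  its inverse: this is the cotractor written \<open>(J/n \<sigma> | \<mu>\<^sub>a | \<sigma>)\<close>.\<close>

definition cotractor_inclusion ::
  "('m::topological_space, 'n::finite) chart set \<Rightarrow> (('m, 'n) chart \<Rightarrow> real^'n \<Rightarrow> real^'n^'n) \<Rightarrow>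
   (('m, 'n) chart \<Rightarrow> real^'n \<Rightarrow> real^'n^'n^'n) \<Rightarrow> ('m, 'n) chart \<Rightarrow> 'm \<Rightarrow>
   ('m, 'n) density set \<Rightarrow> ('m, 'n) density set set" where
  "cotractor_inclusion A g \<Gamma> c p U =
     (let (\<mu>, \<sigma>) = proj_split g c p U
      in inv_into (conf_cotractors A g p) (conf_split g \<Gamma> c p)
           (1 / real CARD('n) * conf_J g \<Gamma> c (coord c p) * \<sigma>, \<mu>, \<sigma>))"

end

theory Submission
  imports Defs
begin

text \<open>The cotractor inclusion is defined through a right inverse of the conformal splitting, so the point
  is that this splitting is well defined on classes of 2-jets and surjective onto
  \<open>\<real> \<oplus> T\<^sup>*M \<oplus> \<real>\<close>.  For surjectivity one takes the density which, trivialised by \<open>g\<close>, is a quadratic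
  polynomial in the coordinates of the given chart, with second derivatives a multiple of \<open>g\<^sub>a\<^sub>b\<close>.
  The Einstein condition \<open>Ric = (n - 1) \<lambda> g\<close> gives the conformal Schouten tensor \<open>\<lambda>/2 g\<close>, hence
  \<open>J = n \<lambda>/2\<close>, and the cross terms of the conformal tractor metric become
  \<open>2 (J/n) \<sigma> \<sigma>' = \<lambda> \<sigma> \<sigma>'\<close>.\<close>

section \<open>Functions of class \<open>C\<^sup>k\<close>\<close>

text \<open>\<open>frechet_derivative\<close> is a choice among all derivatives at the point.
  Functions that agree near \<open>x\<close> have the same derivatives there, so the same one is
  chosen.\<close>

lemma frechet_derivative_cong_open:
  assumes "open S" "x \<in> S" "\<And>y. y \<in> S \<Longrightarrow> f y = g y"
  shows "frechet_derivative f (at x) = frechet_derivative g (at x)"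
proof -
  have "(f has_derivative D) (at x) \<longleftrightarrow> (g has_derivative D) (at x)" for D
    using has_derivative_transform_within_open[OF _ assms(1,2)] assms(3) by metis
  then show ?thesis by (simp add: frechet_derivative_def)
qed

text \<open>Openness of \<open>S\<close> matters because \<open>Ck_on\<close> takes derivatives at
  \<open>x\<close>, not within \<open>S\<close>; agreement on \<open>S\<close> must therefore be
  agreement on a neighbourhood.\<close>

lemma Ck_on_cong:
  assumes "open S" "\<And>y. y \<in> S \<Longrightarrow> f y = g y"
  shows "Ck_on k f S \<longleftrightarrow> Ck_on k g S"
  using assms(2)
proof (induction k arbitrary: f g)
  case 0
  then show ?case using continuous_on_cong[of S S f g] by auto
next
  case (Suc k)
  have "f differentiable_on S \<longleftrightarrow> g differentiable_on S"
    using has_derivative_transform[of _ S f g] has_derivative_transform[of _ S g f] Suc.prems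
    unfolding differentiable_on_def differentiable_def by metis
  moreover have "Ck_on k (\<lambda>x. frechet_derivative f (at x) v) S \<longleftrightarrow>
      Ck_on k (\<lambda>x. frechet_derivative g (at x) v) S" for v
    using frechet_derivative_cong_open[OF assms(1) _ Suc.prems] by (intro Suc.IH) simp
  ultimately show ?case by simp
qed

lemma Ck_on_SucD: "Ck_on (Suc k) f S \<Longrightarrow> Ck_on k f S"
  by (induction k arbitrary: f) (auto simp: differentiable_imp_continuous_on)

lemma Ck_on_subset: "Ck_on k f S \<Longrightarrow> T \<subseteq> S \<Longrightarrow> Ck_on k f T"
  by (induction k arbitrary: f) (auto intro: continuous_on_subset differentiable_on_subset)

lemma Ck_on_Suc_has_derivative:
  assumes "Ck_on (Suc k) f S" "open S" "x \<in> S"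
  shows "(f has_derivative frechet_derivative f (at x)) (at x)"
  using assms by (auto simp: differentiable_on_eq_differentiable_at frechet_derivative_works[symmetric])

text \<open>This lets later inductions exhibit an explicit derivative \<open>D\<close>: at each
  point of the open set, uniqueness of derivatives identifies it with
  \<open>frechet_derivative\<close>.\<close>

lemma Ck_on_SucI:
  assumes "open S" "\<And>x. x \<in> S \<Longrightarrow> (f has_derivative D x) (at x)"
    and "\<And>v. Ck_on k (\<lambda>x. D x v) S"
  shows "Ck_on (Suc k) f S"
proof -
  have "frechet_derivative f (at x) = D x" if "x \<in> S" for x
    using assms(2)[OF that] frechet_derivative_at by metis
  then have "Ck_on k (\<lambda>x. frechet_derivative f (at x) v) S" for v
    using assms(3) Ck_on_cong[OF assms(1), of "\<lambda>x. frechet_derivative f (at x) v" "\<lambda>x. D x v"]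
    by simp
  moreover have "f differentiable_on S"
    using assms(1,2) differentiableI by (metis differentiable_on_eq_differentiable_at)
  ultimately show ?thesis by simp
qed

lemma Ck_on_const:
  assumes "open S"
  shows "Ck_on k (\<lambda>x. c) S"
proof (induction k arbitrary: c)
  case (Suc k)
  show ?case by (rule Ck_on_SucI[OF assms has_derivative_const Suc])
qed simp

lemma Ck_on_bounded_linear:
  assumes L: "bounded_linear L" and S: "open S"
  shows "Ck_on k f S \<Longrightarrow> Ck_on k (\<lambda>x. L (f x)) S"
proof (induction k arbitrary: f)
  case 0
  then show ?case using bounded_linear.continuous_on[OF L] by simp
next
  case (Suc k)
  show ?case
  proof (rule Ck_on_SucI[OF S])
    show "((\<lambda>x. L (f x)) has_derivative (\<lambda>v. L (frechet_derivative f (at x) v))) (at x)"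
      if "x \<in> S" for x
      using bounded_linear.has_derivative[OF L Ck_on_Suc_has_derivative[OF Suc.prems S that]] .
    show "Ck_on k (\<lambda>x. L (frechet_derivative f (at x) v)) S" for v
      using Suc.prems by (intro Suc.IH) simp
  qed
qed

lemma Ck_on_add:
  assumes S: "open S"
  shows "Ck_on k f S \<Longrightarrow> Ck_on k g S \<Longrightarrow> Ck_on k (\<lambda>x. f x + g x) S"
proof (induction k arbitrary: f g)
  case 0
  then show ?case by (simp add: continuous_on_add)
next
  case (Suc k)
  show ?case
  proof (rule Ck_on_SucI[OF S])
    show "((\<lambda>x. f x + g x) has_derivative
        (\<lambda>v. frechet_derivative f (at x) v + frechet_derivative g (at x) v)) (at x)"
      if "x \<in> S" for x
      using Ck_on_Suc_has_derivative[OF _ S that] Suc.prems by (intro has_derivative_add) blast+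
    show "Ck_on k (\<lambda>x. frechet_derivative f (at x) v + frechet_derivative g (at x) v) S" for v
      using Suc.prems by (intro Suc.IH) simp_all
  qed
qed

lemma Ck_on_mult:
  fixes f g :: "'a::real_normed_vector \<Rightarrow> real"
  assumes S: "open S"
  shows "Ck_on k f S \<Longrightarrow> Ck_on k g S \<Longrightarrow> Ck_on k (\<lambda>x. f x * g x) S"
proof (induction k arbitrary: f g)
  case 0
  then show ?case by (simp add: continuous_on_mult)
next
  case (Suc k)
  show ?case
  proof (rule Ck_on_SucI[OF S])
    show "((\<lambda>x. f x * g x) has_derivative
        (\<lambda>v. f x * frechet_derivative g (at x) v + frechet_derivative f (at x) v * g x)) (at x)"
      if "x \<in> S" for x
      using Ck_on_Suc_has_derivative[OF _ S that] Suc.prems by (intro has_derivative_mult) blast+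
    \<comment> \<open>The Leibniz rule leaves \<open>f\<close> and \<open>g\<close> undifferentiated
      in one factor each, so their class is first lowered from \<open>Suc k\<close> to
      \<open>k\<close>.\<close>
    show "Ck_on k (\<lambda>x. f x * frechet_derivative g (at x) v + frechet_derivative f (at x) v * g x) S"
      for v
      using Suc.prems Ck_on_SucD by (intro Ck_on_add[OF S] Suc.IH) auto
  qed
qed

text \<open>The exponent is generalised in the induction because differentiation replaces
  \<open>a\<close> by \<open>a - 1\<close>. Positivity keeps the base away from the singularity of
  the real power.\<close>

lemma Ck_on_powr:
  fixes f :: "'a::real_normed_vector \<Rightarrow> real"
  assumes S: "open S" and pos: "\<And>x. x \<in> S \<Longrightarrow> f x > 0"
  shows "Ck_on k f S \<Longrightarrow> Ck_on k (\<lambda>x. f x powr a) S"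
proof (induction k arbitrary: a)
  case 0
  have "\<forall>x\<in>S. f x \<noteq> 0" using pos by (metis less_irrefl)
  with 0 show ?case by (auto intro: continuous_on_powr)
next
  case (Suc k)
  show ?case
  proof (rule Ck_on_SucI[OF S])
    show "((\<lambda>x. f x powr a) has_derivative
        (\<lambda>v. a * (f x powr (a - 1) * frechet_derivative f (at x) v))) (at x)"
      if "x \<in> S" for x
    proof -
      have "((\<lambda>y. y powr a) has_real_derivative a * f x powr (a - 1)) (at (f x))"
        using pos[OF that] by (rule has_real_derivative_powr)
      then have "((\<lambda>y. y powr a) has_derivative (\<lambda>v. a * f x powr (a - 1) * v)) (at (f x))"
        by (simp add: has_field_derivative_def)
      from has_derivative_compose[OF Ck_on_Suc_has_derivative[OF Suc.prems S that] this]
      show ?thesis by (simp add: mult.assoc)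
    qed
    show "Ck_on k (\<lambda>x. a * (f x powr (a - 1) * frechet_derivative f (at x) v)) S" for v
      using Suc.prems
      by (intro Ck_on_mult[OF S] Ck_on_const[OF S] Suc.IH[OF Ck_on_SucD]) simp_all
  qed
qed

section \<open>Closure properties of smooth functions\<close>

lemma smooth_on_const: "open S \<Longrightarrow> smooth_on (\<lambda>x. c) S"
  by (simp add: smooth_on_def Ck_on_const)

lemma smooth_on_add:
  "open S \<Longrightarrow> smooth_on f S \<Longrightarrow> smooth_on g S \<Longrightarrow> smooth_on (\<lambda>x. f x + g x) S"
  by (simp add: smooth_on_def Ck_on_add)

lemma smooth_on_mult:
  fixes f g :: "'a::real_normed_vector \<Rightarrow> real"
  shows "open S \<Longrightarrow> smooth_on f S \<Longrightarrow> smooth_on g S \<Longrightarrow> smooth_on (\<lambda>x. f x * g x) S"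
  by (simp add: smooth_on_def Ck_on_mult)

lemma smooth_on_bounded_linear:
  "open S \<Longrightarrow> smooth_on f S \<Longrightarrow> bounded_linear L \<Longrightarrow> smooth_on (\<lambda>x. L (f x)) S"
  by (simp add: smooth_on_def Ck_on_bounded_linear)

lemma smooth_on_diff:
  fixes f g :: "'a::real_normed_vector \<Rightarrow> real"
  assumes "open S" "smooth_on f S" "smooth_on g S"
  shows "smooth_on (\<lambda>x. f x - g x) S"
proof -
  have "smooth_on (\<lambda>x. f x + (-1) * g x) S"
    using assms by (intro smooth_on_add smooth_on_mult smooth_on_const)
  then show ?thesis by simp
qed

lemma smooth_on_sum:
  "open S \<Longrightarrow> (\<And>i. i \<in> I \<Longrightarrow> smooth_on (f i) S) \<Longrightarrow> smooth_on (\<lambda>x. \<Sum>i\<in>I. f i x) S"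
  by (induction I rule: infinite_finite_induct) (auto intro: smooth_on_const smooth_on_add)

lemma smooth_on_prod:
  fixes f :: "'i \<Rightarrow> 'a::real_normed_vector \<Rightarrow> real"
  shows "open S \<Longrightarrow> (\<And>i. i \<in> I \<Longrightarrow> smooth_on (f i) S) \<Longrightarrow> smooth_on (\<lambda>x. \<Prod>i\<in>I. f i x) S"
  by (induction I rule: infinite_finite_induct) (auto intro: smooth_on_const smooth_on_mult)

lemma smooth_on_powr:
  fixes f :: "'a::real_normed_vector \<Rightarrow> real"
  shows "open S \<Longrightarrow> smooth_on f S \<Longrightarrow> (\<And>x. x \<in> S \<Longrightarrow> f x > 0) \<Longrightarrow> smooth_on (\<lambda>x. f x powr a) S"
  by (simp add: smooth_on_def Ck_on_powr)

lemma smooth_on_subset: "smooth_on f S \<Longrightarrow> T \<subseteq> S \<Longrightarrow> smooth_on f T"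
  by (auto simp: smooth_on_def intro: Ck_on_subset)

lemma smooth_on_cong:
  "open S \<Longrightarrow> (\<And>y. y \<in> S \<Longrightarrow> f y = g y) \<Longrightarrow> smooth_on f S \<longleftrightarrow> smooth_on g S"
  unfolding smooth_on_def using Ck_on_cong by metis

lemma smooth_on_vec_nth: "open S \<Longrightarrow> smooth_on f S \<Longrightarrow> smooth_on (\<lambda>x. f x $ i) S"
  using smooth_on_bounded_linear bounded_linear_vec_nth by blast

text \<open>By the permutation expansion, the determinant is a polynomial in the matrix
  entries.\<close>

lemma smooth_on_det:
  fixes M :: "'a::real_normed_vector \<Rightarrow> real^'n^'n"
  assumes "open S" "smooth_on M S"
  shows "smooth_on (\<lambda>x. det (M x)) S"
  unfolding det_def using assms
  by (intro smooth_on_sum smooth_on_mult smooth_on_prod smooth_on_const smooth_on_vec_nth)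

section \<open>Partial derivatives\<close>

lemma pd_eqI: "(f has_derivative D) (at x) \<Longrightarrow> pd i f x = D (axis i 1)"
  using frechet_derivative_at by (fastforce simp: pd_def)

lemma pd_cong_open:
  "open S \<Longrightarrow> x \<in> S \<Longrightarrow> (\<And>y. y \<in> S \<Longrightarrow> f y = g y) \<Longrightarrow> pd i f x = pd i g x"
  unfolding pd_def using frechet_derivative_cong_open by metis

lemma smooth_on_has_derivative:
  "smooth_on f S \<Longrightarrow> open S \<Longrightarrow> x \<in> S \<Longrightarrow> (f has_derivative frechet_derivative f (at x)) (at x)"
  unfolding smooth_on_def using Ck_on_Suc_has_derivative by blast

lemma smooth_on_pd: "smooth_on f S \<Longrightarrow> smooth_on (pd i f) S"
proof -
  assume "smooth_on f S"
  then have "Ck_on (Suc k) f S" for k by (simp add: smooth_on_def del: Ck_on.simps)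
  then show ?thesis by (simp add: smooth_on_def pd_def[abs_def])
qed

lemma pd_const: "pd i (\<lambda>x. c) = (\<lambda>x. 0)"
  by (rule ext, rule pd_eqI) simp

lemma pd_add:
  assumes "open S" "x \<in> S" "smooth_on f S" "smooth_on g S"
  shows "pd i (\<lambda>y. f y + g y) x = pd i f x + pd i g x"
  using pd_eqI[OF has_derivative_add[OF smooth_on_has_derivative[OF assms(3,1,2)]
      smooth_on_has_derivative[OF assms(4,1,2)]]]
  by (simp add: pd_def)

lemma pd_diff:
  assumes "open S" "x \<in> S" "smooth_on f S" "smooth_on g S"
  shows "pd i (\<lambda>y. f y - g y) x = pd i f x - pd i g x"
  using pd_eqI[OF has_derivative_diff[OF smooth_on_has_derivative[OF assms(3,1,2)]
      smooth_on_has_derivative[OF assms(4,1,2)]]]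
  by (simp add: pd_def)

lemma pd_mult:
  assumes "open S" "x \<in> S" "smooth_on f S" "smooth_on g S"
  shows "pd i (\<lambda>y. f y * g y) x = f x * pd i g x + pd i f x * g x"
  using pd_eqI[OF has_derivative_mult[OF smooth_on_has_derivative[OF assms(3,1,2)]
      smooth_on_has_derivative[OF assms(4,1,2)]]]
  by (simp add: pd_def)

lemma pd_pd_diff:
  assumes "open S" "x \<in> S" "smooth_on f S" "smooth_on g S"
  shows "pd i (pd j (\<lambda>y. f y - g y)) x = pd i (pd j f) x - pd i (pd j g) x"
proof -
  have "pd i (pd j (\<lambda>y. f y - g y)) x = pd i (\<lambda>y. pd j f y - pd j g y) x"
    using assms by (intro pd_cong_open[OF assms(1,2)] pd_diff)
  then show ?thesis using assms by (simp add: pd_diff smooth_on_pd)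
qed

lemma pd_pd_mult:
  assumes "open S" "x \<in> S" "smooth_on f S" "smooth_on g S"
  shows "pd i (pd j (\<lambda>y. f y * g y)) x =
    f x * pd i (pd j g) x + pd i f x * pd j g x + pd j f x * pd i g x + pd i (pd j f) x * g x"
proof -
  have "pd i (pd j (\<lambda>y. f y * g y)) x = pd i (\<lambda>y. f y * pd j g y + pd j f y * g y) x"
    using assms by (intro pd_cong_open[OF assms(1,2)] pd_mult)
  also have "\<dots> = pd i (\<lambda>y. f y * pd j g y) x + pd i (\<lambda>y. pd j f y * g y) x"
    using assms by (intro pd_add smooth_on_mult smooth_on_pd)
  finally show ?thesis using assms by (simp add: pd_mult smooth_on_pd)
qed

section \<open>Quadratic polynomials with prescribed 2-jet\<close>

lemma has_derivative_vec_nth: "((\<lambda>y. y $ a) has_derivative (\<lambda>v. v $ a)) (at x)"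
  by (intro bounded_linear_imp_has_derivative bounded_linear_vec_nth)

text \<open>For symmetric \<open>G\<close> this is the Taylor polynomial at \<open>x\<close> with
  value \<open>\<sigma>\<close>, gradient \<open>\<mu>\<close> and Hessian \<open>G\<close>.\<close>

definition quadratic :: "real^'n \<Rightarrow> real \<Rightarrow> real^'n \<Rightarrow> real^'n^'n \<Rightarrow> real^'n \<Rightarrow> real" where
  "quadratic x \<sigma> \<mu> G y = \<sigma> + (\<Sum>a\<in>UNIV. \<mu> $ a * (y $ a - x $ a))
     + (\<Sum>a\<in>UNIV. \<Sum>b\<in>UNIV. G $ a $ b / 2 * ((y $ a - x $ a) * (y $ b - x $ b)))"

lemma pd_quadratic:
  assumes "transpose G = G"
  shows "pd i (quadratic x \<sigma> \<mu> G) y = \<mu> $ i + (\<Sum>b\<in>UNIV. G $ i $ b * (y $ b - x $ b))"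
proof -
  have G_sym: "G $ a $ b = G $ b $ a" for a b
    using assms by (metis transpose_def vec_lambda_beta)
  have "pd i (quadratic x \<sigma> \<mu> G) y = (\<Sum>a\<in>UNIV. \<mu> $ a * axis i 1 $ a)
     + (\<Sum>a\<in>UNIV. \<Sum>b\<in>UNIV. G $ a $ b / 2 *
         ((y $ a - x $ a) * axis i 1 $ b + axis i 1 $ a * (y $ b - x $ b)))"
    unfolding quadratic_def[abs_def]
    by (rule pd_eqI) (auto intro!: derivative_eq_intros has_derivative_vec_nth)
  \<comment> \<open>One of the two double sums is reordered, so that in both the inner sum runs over
    the index of the axis vector and collapses to a single term. Symmetry of \<open>G\<close> then
    makes the two halves equal.\<close>
  also have "\<dots> = (\<Sum>a\<in>UNIV. \<mu> $ a * axis i 1 $ a)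
      + (\<Sum>a\<in>UNIV. \<Sum>b\<in>UNIV. G $ a $ b / 2 * (y $ a - x $ a) * axis i 1 $ b)
      + (\<Sum>b\<in>UNIV. \<Sum>a\<in>UNIV. G $ a $ b / 2 * (y $ b - x $ b) * axis i 1 $ a)"
    by (subst (3) sum.swap) (simp add: sum.distrib distrib_left mult_ac)
  also have "\<dots> = \<mu> $ i + (\<Sum>a\<in>UNIV. G $ a $ i / 2 * (y $ a - x $ a))
      + (\<Sum>b\<in>UNIV. G $ i $ b / 2 * (y $ b - x $ b))"
    by (simp add: axis_def if_distrib cong: if_cong)
  also have "\<dots> = \<mu> $ i + (\<Sum>b\<in>UNIV. G $ i $ b * (y $ b - x $ b))"
    by (simp add: G_sym[of _ i] sum.distrib[symmetric] add.assoc)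
  finally show ?thesis .
qed

lemma pd_pd_quadratic:
  assumes "transpose G = G"
  shows "pd i (pd j (quadratic x \<sigma> \<mu> G)) y = G $ j $ i"
proof -
  have "pd i (pd j (quadratic x \<sigma> \<mu> G)) y =
      pd i (\<lambda>y. \<mu> $ j + (\<Sum>b\<in>UNIV. G $ j $ b * (y $ b - x $ b))) y"
    by (rule arg_cong[of _ _ "\<lambda>f. pd i f y"], rule ext, rule pd_quadratic[OF assms])
  also have "\<dots> = (\<Sum>b\<in>UNIV. G $ j $ b * axis i 1 $ b)"
    by (rule pd_eqI) (auto intro!: derivative_eq_intros has_derivative_vec_nth)
  also have "\<dots> = G $ j $ i" by (simp add: axis_def if_distrib cong: if_cong)
  finally show ?thesis .
qed

text \<open>It will be applied to a transition map \<open>f\<close>. As the outer function is a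
  polynomial, sums and products of the components of \<open>f\<close> suffice, without a chain rule
  for higher derivatives.\<close>

lemma smooth_on_quadratic_compose:
  assumes "open S" "smooth_on f S"
  shows "smooth_on (\<lambda>y. quadratic x \<sigma> \<mu> G (f y)) S"
  unfolding quadratic_def using assms
  by (intro smooth_on_sum smooth_on_add smooth_on_mult smooth_on_const smooth_on_diff smooth_on_vec_nth)

section \<open>Traces and the conformal Schouten tensor\<close>

lemma gtrace_diff: "gtrace G T - gtrace G T' = gtrace G (T - T')"
  by (simp add: gtrace_def sum_subtractf right_diff_distrib)

lemma gtrace_scaleR: "gtrace G (r *\<^sub>R T) = r * gtrace G T"
  by (simp add: gtrace_def sum_distrib_left mult_ac)

text \<open>Each diagonal entry of \<open>matrix_inv G ** G\<close> is 1; symmetry of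
  \<open>G\<close> turns their sum into the contraction.\<close>

lemma gtrace_self:
  fixes G :: "real^'n^'n"
  assumes "transpose G = G" "invertible G"
  shows "gtrace G G = real CARD('n)"
proof -
  have G_sym: "G $ a $ b = G $ b $ a" for a b
    using assms(1) by (metis transpose_def vec_lambda_beta)
  have "matrix_inv G ** G = mat 1"
    using someI_ex[OF assms(2)[unfolded invertible_def]] by (simp add: matrix_inv_def)
  then have "(matrix_inv G ** G) $ a $ a = 1" for a by (simp add: mat_def)
  moreover have "(matrix_inv G ** G) $ a $ a = (\<Sum>b\<in>UNIV. matrix_inv G $ a $ b * G $ a $ b)" for a
    unfolding matrix_matrix_mult_def vec_lambda_beta
    by (intro sum.cong refl arg_cong2[of _ _ _ _ "(*)"] G_sym)
  ultimately show ?thesis by (simp add: gtrace_def)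
qed

text \<open>The tensor \<open>lam / 2\<close> times \<open>g\<close> solves the Schouten equation
  because \<open>(n - 2) * lam / 2 + n * lam / 2 = (n - 1) * lam\<close>. As
  \<open>conf_schouten\<close> is a definite description, uniqueness is also required.\<close>

lemma conf_J_eq:
  fixes g :: "('m, 'n::finite) chart \<Rightarrow> real^'n \<Rightarrow> real^'n^'n"
  assumes n: "CARD('n) \<ge> 3" and G: "transpose (g c x) = g c x" "invertible (g c x)"
    and P: "proj_schouten \<Gamma> c x = lam *\<^sub>R g c x"
  shows "conf_J g \<Gamma> c x = real CARD('n) * lam / 2"
proof -
  let ?n = "real CARD('n)" and ?G = "g c x"
  have n3: "?n \<ge> 3" using n by simp
  have "(?n - 1) *\<^sub>R proj_schouten \<Gamma> c x = ricci \<Gamma> c x"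
    using n3 by (simp add: proj_schouten_def)
  then have ric: "ricci \<Gamma> c x = ((?n - 1) * lam) *\<^sub>R ?G" using P by simp
  have tr: "gtrace ?G ?G = ?n" using gtrace_self[OF G] .
  have "conf_schouten g \<Gamma> c x = (lam / 2) *\<^sub>R ?G"
    unfolding conf_schouten_def
  proof (rule the_equality)
    show "ricci \<Gamma> c x = (?n - 2) *\<^sub>R (lam / 2) *\<^sub>R ?G + gtrace ?G ((lam / 2) *\<^sub>R ?G) *\<^sub>R ?G"
      by (simp add: ric gtrace_scaleR tr scaleR_add_left[symmetric] algebra_simps)
  next
    fix T assume T: "ricci \<Gamma> c x = (?n - 2) *\<^sub>R T + gtrace ?G T *\<^sub>R ?G"
    \<comment> \<open>Since \<open>n - 2\<close> is nonzero, the equation forces any solution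
      \<open>T\<close> to be \<open>r\<close> times the metric; taking the trace then determines
      \<open>r\<close>.\<close>
    define r where "r = ((?n - 1) * lam - gtrace ?G T) / (?n - 2)"
    have "(?n - 2) *\<^sub>R T = ((?n - 1) * lam - gtrace ?G T) *\<^sub>R ?G"
      using T ric by (simp add: scaleR_diff_left)
    then have "(1 / (?n - 2)) *\<^sub>R (?n - 2) *\<^sub>R T = r *\<^sub>R ?G"
      by (simp add: r_def)
    then have Tr: "T = r *\<^sub>R ?G" using n3 by simp
    then have "gtrace ?G T = r * ?n" using gtrace_scaleR[of ?G r ?G] tr by simp
    then have "r * (?n - 2) = (?n - 1) * lam - r * ?n"
      using n3 by (simp add: r_def)
    then have "(?n - 1) * (2 * r) = (?n - 1) * lam" by (simp add: algebra_simps)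
    then have "r = lam / 2" using n3 by simp
    then show "T = (lam / 2) *\<^sub>R ?G" using Tr by simp
  qed
  then show ?thesis by (simp add: conf_J_def gtrace_scaleR tr)
qed

section \<open>Densities with a given 2-jet\<close>

lemma open_coord_image:
  assumes "smooth_atlas A" "c \<in> A" "open W"
  shows "open (coord c ` (cdom c \<inter> W))"
proof -
  have h: "homeomorphism (cdom c) (cimg c) (coord c) (param c)" "open (cimg c)"
    using assms by (auto simp: smooth_atlas_def)
  have "openin (top_of_set (cdom c)) (cdom c \<inter> W)" using assms(3) by (simp add: openin_open_Int)
  then have "openin (top_of_set (cimg c)) (coord c ` (cdom c \<inter> W))"
    using homeomorphism_imp_open_map[OF h(1)] by blast
  then show ?thesis using h(2) openin_open_trans by blast
qed

lemma param_coord: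
  assumes "smooth_atlas A" "c \<in> A" "q \<in> cdom c"
  shows "param c (coord c q) = q"
  using assms by (auto simp: smooth_atlas_def homeomorphism_def)

lemma coord_param:
  assumes "smooth_atlas A" "c \<in> A" "y \<in> cimg c"
  shows "coord c (param c y) = y"
  using assms by (auto simp: smooth_atlas_def homeomorphism_def)

section \<open>The positive density determined by the metric\<close>

lemma det_metric_nonzero:
  assumes "pseudo_riemannian_metric A g" "c \<in> A" "x \<in> cimg c"
  shows "det (g c x) \<noteq> 0"
  using assms by (auto simp: pseudo_riemannian_metric_def invertible_det_nz)

text \<open>The divisor in \<open>trivialise\<close>, regarded as a density in its own right; it is
  the section whose trivialisation is 1.\<close>

definition vol_density ::
  "nat \<Rightarrow> (('m, 'n::finite) chart \<Rightarrow> real^'n \<Rightarrow> real^'n^'n) \<Rightarrow> ('m, 'n) density" where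
  "vol_density k g c x = root k (1 / \<bar>det (g c x)\<bar>)"

text \<open>The absolute value is traded for a square, so that for \<open>r = det g\<close> the
  right-hand side is a real power of a smooth positive function.\<close>

lemma root_inverse_abs:
  assumes "k > 0" "r \<noteq> 0"
  shows "root k (1 / \<bar>r\<bar>) = (r\<^sup>2) powr (- 1 / (2 * real k))"
proof -
  have "1 / \<bar>r\<bar> = \<bar>r\<bar> powr (-1)"
    using assms by (simp add: powr_minus divide_inverse)
  moreover have "root k (1 / \<bar>r\<bar>) = (1 / \<bar>r\<bar>) powr (1 / real k)"
    using assms by (intro root_powr_inverse) auto
  ultimately have "root k (1 / \<bar>r\<bar>) = (\<bar>r\<bar> powr (-1)) powr (1 / real k)" by (simp only:)
  also have "\<dots> = \<bar>r\<bar> powr (2 * (- 1 / (2 * real k)))"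
    unfolding powr_powr by simp
  also have "\<dots> = (\<bar>r\<bar> powr 2) powr (- 1 / (2 * real k))"
    unfolding powr_powr by simp
  also have "\<bar>r\<bar> powr 2 = r\<^sup>2" using assms by simp
  finally show ?thesis .
qed

lemma vol_density_pos:
  assumes "pseudo_riemannian_metric A g" "c \<in> A" "x \<in> cimg c" "k > 0"
  shows "vol_density k g c x > 0"
  using det_metric_nonzero[OF assms(1-3)] assms(4) by (simp add: vol_density_def)

lemma
  assumes A: "smooth_atlas A" and g: "pseudo_riemannian_metric A g" and c: "c \<in> A" and k: "k > 0"
  shows smooth_on_vol_density: "smooth_on (vol_density k g c) (cimg c)"
    and smooth_on_inverse_vol_density: "smooth_on (\<lambda>x. 1 / vol_density k g c x) (cimg c)"
proof -
  have o: "open (cimg c)" using A c by (simp add: smooth_atlas_def)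
  have "smooth_on (\<lambda>x. det (g c x)) (cimg c)"
    using g c by (intro smooth_on_det o) (auto simp: pseudo_riemannian_metric_def)
  then have "smooth_on (\<lambda>x. (det (g c x))\<^sup>2) (cimg c)"
    using smooth_on_mult[OF o] by (simp add: power2_eq_square)
  then have s: "smooth_on (\<lambda>x. ((det (g c x))\<^sup>2) powr a) (cimg c)" for a
    using det_metric_nonzero[OF g c] by (intro smooth_on_powr o) auto
  have eq: "vol_density k g c x = ((det (g c x))\<^sup>2) powr (- 1 / (2 * real k))" if "x \<in> cimg c" for x
    using root_inverse_abs[OF k det_metric_nonzero[OF g c that]] by (simp add: vol_density_def)
  show "smooth_on (vol_density k g c) (cimg c)"
    using smooth_on_cong[OF o, of "vol_density k g c"
      "\<lambda>x. ((det (g c x))\<^sup>2) powr (- 1 / (2 * real k))"] eq s by blast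
  have "1 / vol_density k g c x = ((det (g c x))\<^sup>2) powr (1 / (2 * real k))" if "x \<in> cimg c" for x
    using eq[OF that] by (simp add: powr_minus_divide)
  then show "smooth_on (\<lambda>x. 1 / vol_density k g c x) (cimg c)"
    using smooth_on_cong[OF o, of "\<lambda>x. 1 / vol_density k g c x"
      "\<lambda>x. ((det (g c x))\<^sup>2) powr (1 / (2 * real k))"] s by blast
qed

text \<open>Taking determinants in the transformation law of the metric produces the squared
  Jacobian determinant, and \<open>root k\<close> is multiplicative.\<close>

lemma vol_density_transform:
  assumes A: "smooth_atlas A" and g: "pseudo_riemannian_metric A g"
    and c: "c \<in> A" "d \<in> A" "q \<in> cdom c" "q \<in> cdom d" and k: "k > 0"
  shows "vol_density k g d (coord d q) =
    root k ((det (jacobian c d (coord c q)))\<^sup>2) * vol_density k g c (coord c q)"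
proof -
  let ?J = "jacobian c d (coord c q)"
  have "coord c q \<in> overlap c d" using c by (auto simp: overlap_def)
  then have "g c (coord c q) = transpose ?J ** g d (transition c d (coord c q)) ** ?J"
    using g c unfolding pseudo_riemannian_metric_def by blast
  also have "transition c d (coord c q) = coord d q"
    using param_coord[OF A c(1,3)] by (simp add: transition_def)
  finally have "det (g c (coord c q)) = (det ?J)\<^sup>2 * det (g d (coord d q))"
    by (simp add: det_mul det_transpose power2_eq_square mult_ac)
  \<comment> \<open>By the preceding identity this also makes \<open>det ?J\<close> nonzero, as the
    passage to reciprocals requires.\<close>
  moreover have "det (g c (coord c q)) \<noteq> 0"
    using det_metric_nonzero[OF g c(1)] c(3) by (auto simp: cimg_def)
  ultimately have "1 / \<bar>det (g d (coord d q))\<bar> = (det ?J)\<^sup>2 * (1 / \<bar>det (g c (coord c q))\<bar>)"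
    by (auto simp: abs_mult)
  then show ?thesis by (simp only: vol_density_def real_root_mult)
qed

text \<open>The neighbourhood of \<open>p\<close> is \<open>cdom c\<close>. The factor built from
  \<open>f\<close> takes the value \<open>f (coord c q)\<close> at \<open>q\<close> in every chart,
  so only \<open>vol_density\<close> contributes to the transformation law.\<close>

lemma density_of_function:
  assumes A: "smooth_atlas A" and g: "pseudo_riemannian_metric A g"
    and c: "c \<in> A" "p \<in> cdom c" and k: "k > 0"
    and f: "\<And>d. d \<in> A \<Longrightarrow> smooth_on (\<lambda>y. f (transition d c y)) (overlap d c)"
  shows "(\<lambda>d y. vol_density k g d y * f (transition d c y)) \<in> densities A k p"
proof -
  have "open (cdom c)" using A c by (auto simp: smooth_atlas_def)
  moreover have "smooth_on (\<lambda>y. vol_density k g d y * f (transition d c y))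
      (coord d ` (cdom d \<inter> cdom c))" if d: "d \<in> A" for d
  proof (rule smooth_on_mult)
    show "open (coord d ` (cdom d \<inter> cdom c))"
      using open_coord_image[OF A d \<open>open (cdom c)\<close>] .
    show "smooth_on (vol_density k g d) (coord d ` (cdom d \<inter> cdom c))"
      by (rule smooth_on_subset[OF smooth_on_vol_density[OF A g d k]]) (auto simp: cimg_def)
    show "smooth_on (\<lambda>y. f (transition d c y)) (coord d ` (cdom d \<inter> cdom c))"
      using f[OF d] by (simp add: overlap_def)
  qed
  moreover have "vol_density k g d (coord d q) * f (transition d c (coord d q)) =
      root k ((det (jacobian e d (coord e q)))\<^sup>2) *
        (vol_density k g e (coord e q) * f (transition e c (coord e q)))"
    if "e \<in> A" "d \<in> A" "q \<in> cdom e \<inter> cdom d \<inter> cdom c" for e d q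
    using that vol_density_transform[OF A g that(1,2) _ _ k, of q] param_coord[OF A]
    by (simp add: transition_def)
  ultimately show ?thesis
    using c(2) unfolding densities_def by blast
qed

text \<open>Each density is smooth only near \<open>p\<close>, on a neighbourhood of its own;
  intersecting two of them gives a common open set on which the product and difference rules
  apply.\<close>

lemma densities_smooth_near:
  assumes A: "smooth_atlas A" and c: "c \<in> A" "p \<in> cdom c"
    and s: "s \<in> densities A k p" and t: "t \<in> densities A k p"
  obtains S where "open S" "coord c p \<in> S" "S \<subseteq> cimg c" "smooth_on (s c) S" "smooth_on (t c) S"
proof -
  obtain W W' where W: "open W" "p \<in> W" "smooth_on (s c) (coord c ` (cdom c \<inter> W))"
    and W': "open W'" "p \<in> W'" "smooth_on (t c) (coord c ` (cdom c \<inter> W'))"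
    using s t c unfolding densities_def by blast
  let ?S = "coord c ` (cdom c \<inter> (W \<inter> W'))"
  have "open ?S" "coord c p \<in> ?S" "?S \<subseteq> cimg c"
    using open_coord_image[OF A c(1), of "W \<inter> W'"] W W' c(2) by (auto simp: cimg_def)
  moreover have "smooth_on (s c) ?S" "smooth_on (t c) ?S"
    using W(3) W'(3) by (auto elim!: smooth_on_subset)
  ultimately show thesis by (rule that)
qed

section \<open>The conformal splitting\<close>

text \<open>The formula of \<open>conf_split\<close> for an explicit density instead of one picked
  by \<open>SOME\<close>, so that independence of the representative can be stated.\<close>

definition conf_split_density ::
  "(('m, 'n::finite) chart \<Rightarrow> real^'n \<Rightarrow> real^'n^'n) \<Rightarrow>
   (('m, 'n) chart \<Rightarrow> real^'n \<Rightarrow> real^'n^'n^'n) \<Rightarrow> ('m, 'n) chart \<Rightarrow> 'm \<Rightarrow>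
   ('m, 'n) density \<Rightarrow> real \<times> (real^'n) \<times> real" where
  "conf_split_density g \<Gamma> c p s =
     (let \<sigma> = trivialise (2 * CARD('n)) g s c; x = coord c p;
          \<Delta>\<sigma> = gtrace (g c x)
            (\<chi> a b. pd a (pd b \<sigma>) x - (\<Sum>e\<in>UNIV. \<Gamma> c x $ e $ a $ b * pd e \<sigma> x))
      in (- (\<Delta>\<sigma> + conf_J g \<Gamma> c x * \<sigma> x) / real CARD('n), (\<chi> a. pd a \<sigma> x), \<sigma> x))"

lemma conf_split_eq: "conf_split g \<Gamma> c p V = conf_split_density g \<Gamma> c p (SOME s. s \<in> \<Union>V)"
  by (simp add: conf_split_def conf_split_density_def)

text \<open>Trivialising multiplies by a smooth function \<open>h\<close>. In the second derivatives
  of the product, every term except \<open>h\<close> times the second derivatives depends only on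
  the 1-jet, so the traces stay equal.\<close>

lemma conf_split_density_cong:
  fixes g :: "('m::topological_space, 'n::finite) chart \<Rightarrow> real^'n \<Rightarrow> real^'n^'n"
  assumes A: "smooth_atlas A" and g: "pseudo_riemannian_metric A g" and c: "c \<in> A" "p \<in> cdom c"
    and s: "s \<in> densities A (2 * CARD('n)) p" and t: "t \<in> densities A (2 * CARD('n)) p"
    and jet: "jet1_eq A p s t"
    and tr: "gtrace (g c (coord c p)) (\<chi> a b. pd a (pd b (s c)) (coord c p)) =
      gtrace (g c (coord c p)) (\<chi> a b. pd a (pd b (t c)) (coord c p))"
  shows "conf_split_density g \<Gamma> c p s = conf_split_density g \<Gamma> c p t"
proof -
  let ?k = "2 * CARD('n)" and ?x = "coord c p"
  define h where "h y = 1 / vol_density ?k g c y" for y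
  obtain S where S: "open S" "?x \<in> S" and "S \<subseteq> cimg c"
    and sm: "smooth_on (s c) S" "smooth_on (t c) S"
    using densities_smooth_near[OF A c s t] .
  have hS: "smooth_on h S"
    using smooth_on_subset[OF smooth_on_inverse_vol_density[OF A g c(1), of ?k] \<open>S \<subseteq> cimg c\<close>]
    by (simp add: h_def[abs_def])
  have triv: "trivialise ?k g u c = (\<lambda>y. u c y * h y)" for u
    by (simp add: trivialise_def h_def vol_density_def fun_eq_iff)
  have eq: "s c ?x = t c ?x" "pd i (s c) ?x = pd i (t c) ?x" for i
    using jet c by (auto simp: jet1_eq_def)
  have eq1: "pd i (\<lambda>y. s c y * h y) ?x = pd i (\<lambda>y. t c y * h y) ?x" for i
    using sm hS by (simp add: pd_mult[OF S] eq)
  have eq2: "pd a (pd b (\<lambda>y. s c y * h y)) ?x - pd a (pd b (\<lambda>y. t c y * h y)) ?x =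
      h ?x * (pd a (pd b (s c)) ?x - pd a (pd b (t c)) ?x)" for a b
    using sm hS by (simp add: pd_pd_mult[OF S] eq algebra_simps)
  let ?T = "\<lambda>u. \<chi> a b. pd a (pd b (\<lambda>y. u c y * h y)) ?x
      - (\<Sum>e\<in>UNIV. \<Gamma> c ?x $ e $ a $ b * pd e (\<lambda>y. u c y * h y) ?x)"
  \<comment> \<open>The connection terms involve only first derivatives and cancel by
    \<open>eq1\<close>.\<close>
  have "?T s - ?T t = h ?x *\<^sub>R ((\<chi> a b. pd a (pd b (s c)) ?x) - (\<chi> a b. pd a (pd b (t c)) ?x))"
    using eq2 by (simp add: vec_eq_iff eq1)
  then have "gtrace (g c ?x) (?T s) - gtrace (g c ?x) (?T t) = 0"
    by (simp only: gtrace_diff gtrace_scaleR) (simp add: tr flip: gtrace_diff)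
  then have "gtrace (g c ?x) (?T s) = gtrace (g c ?x) (?T t)" by simp
  then show ?thesis
    by (simp add: conf_split_density_def triv eq eq1 Let_def)
qed

text \<open>The class generated by \<open>s\<close> serves as \<open>V\<close>. Whatever density
  \<open>SOME\<close> picks from it is linked to \<open>s\<close> by steps that all preserve
  \<open>conf_split_density\<close>.\<close>

lemma conf_split_class:
  fixes g :: "('m::topological_space, 'n::finite) chart \<Rightarrow> real^'n \<Rightarrow> real^'n^'n"
  assumes A: "smooth_atlas A" and g: "pseudo_riemannian_metric A g" and c: "c \<in> A" "p \<in> cdom c"
    and s: "s \<in> densities A (2 * CARD('n)) p"
  shows "\<exists>V \<in> conf_cotractors A g p. conf_split g \<Gamma> c p V = conf_split_density g \<Gamma> c p s"
proof -
  let ?k = "2 * CARD('n)" and ?x = "coord c p"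
  let ?D = "densities A ?k p"
  define R where "R = {(s, t). s \<in> ?D \<and> t \<in> ?D \<and> jet2_eq A p s t}"
  define Q where "Q = {(j, j'). j \<in> jets2 A ?k p \<and> j' \<in> jets2 A ?k p \<and>
        (\<exists>s\<in>j. \<exists>t\<in>j'. jet1_eq A p s t \<and>
          (\<forall>c\<in>A. p \<in> cdom c \<longrightarrow> gtrace (g c (coord c p))
             (\<chi> a b. pd a (pd b (\<lambda>y. s c y - t c y)) (coord c p)) = 0))}"
  define V where "V = Q `` {R `` {s}}"
  have jR: "jets2 A ?k p = ?D // R" by (simp add: jets2_def R_def)
  have js: "R `` {s} \<in> jets2 A ?k p" using s by (auto simp: jR quotient_def)
  have V: "V \<in> conf_cotractors A g p"
    unfolding conf_cotractors_def V_def Q_def[symmetric] using js by (rule quotientI)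
  have sR: "s \<in> R `` {s}" using s by (auto simp: R_def jet2_eq_def jet1_eq_def)
  \<comment> \<open>Reflexivity at this jet puts \<open>s\<close> itself into the union of
    \<open>V\<close>, so the choice made by \<open>SOME\<close> is from a nonempty set.\<close>
  have "(R `` {s}, R `` {s}) \<in> Q"
    unfolding Q_def using js sR
    by (auto simp: jet1_eq_def pd_const gtrace_def intro!: bexI[of _ s])
  then have sV: "s \<in> \<Union>V" using sR by (auto simp: V_def)
  have R_eq: "conf_split_density g \<Gamma> c p u = conf_split_density g \<Gamma> c p v" if "(u, v) \<in> R" for u v
    using that c by (intro conf_split_density_cong[OF A g c]) (auto simp: R_def jet2_eq_def)
  have "conf_split_density g \<Gamma> c p t = conf_split_density g \<Gamma> c p s" if t: "t \<in> \<Union>V" for t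
  proof -
    \<comment> \<open>The chain runs from \<open>s\<close> to \<open>u\<close> inside one 2-jet,
      from \<open>u\<close> to \<open>v\<close> by a trace-free change, and from \<open>v\<close> to
      \<open>t\<close> inside the jet \<open>j\<close>, where both are compared with a generator
      \<open>w\<close>.\<close>
    obtain j where j: "t \<in> j" "(R `` {s}, j) \<in> Q" using t by (auto simp: V_def)
    then obtain u v where uv: "u \<in> R `` {s}" "v \<in> j" "jet1_eq A p u v"
      "gtrace (g c ?x) (\<chi> a b. pd a (pd b (\<lambda>y. u c y - v c y)) ?x) = 0"
      using c unfolding Q_def by blast
    obtain w where w: "j = R `` {w}" using j(2) by (auto simp: Q_def jR quotient_def)
    have "u \<in> ?D" "v \<in> ?D" using uv w by (auto simp: R_def)
    obtain S where S: "open S" "?x \<in> S" and "smooth_on (u c) S" "smooth_on (v c) S"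
      using densities_smooth_near[OF A c \<open>u \<in> ?D\<close> \<open>v \<in> ?D\<close>] .
    from this(3,4) have "(\<chi> a b. pd a (pd b (\<lambda>y. u c y - v c y)) ?x) =
        (\<chi> a b. pd a (pd b (u c)) ?x) - (\<chi> a b. pd a (pd b (v c)) ?x)"
      by (simp add: vec_eq_iff pd_pd_diff[OF S])
    then have "gtrace (g c ?x) (\<chi> a b. pd a (pd b (u c)) ?x) =
        gtrace (g c ?x) (\<chi> a b. pd a (pd b (v c)) ?x)"
      using uv(4) by (simp flip: gtrace_diff)
    then have "conf_split_density g \<Gamma> c p u = conf_split_density g \<Gamma> c p v"
      using \<open>u \<in> ?D\<close> \<open>v \<in> ?D\<close> uv(3) by (intro conf_split_density_cong[OF A g c])
    moreover have "conf_split_density g \<Gamma> c p s = conf_split_density g \<Gamma> c p u"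
      using uv(1) by (intro R_eq) auto
    moreover have "conf_split_density g \<Gamma> c p w = conf_split_density g \<Gamma> c p v"
      "conf_split_density g \<Gamma> c p w = conf_split_density g \<Gamma> c p t"
      using uv(2) j(1) w by (auto intro!: R_eq)
    ultimately show ?thesis by simp
  qed
  then have "conf_split g \<Gamma> c p V = conf_split_density g \<Gamma> c p s"
    unfolding conf_split_eq using sV by (metis someI)
  with V show ?thesis by blast
qed

text \<open>Surjectivity makes \<open>inv_into\<close> in \<open>cotractor_inclusion\<close> return
  a genuine preimage, whose splitting is the prescribed triple.\<close>

lemma conf_split_surj:
  fixes g :: "('m::topological_space, 'n::finite) chart \<Rightarrow> real^'n \<Rightarrow> real^'n^'n"
  assumes A: "smooth_atlas A" and g: "pseudo_riemannian_metric A g" and c: "c \<in> A" "p \<in> cdom c"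
  shows "(\<tau>, \<mu>, \<sigma>) \<in> conf_split g \<Gamma> c p ` conf_cotractors A g p"
proof -
  let ?k = "2 * CARD('n)" and ?n = "real CARD('n)" and ?x = "coord c p"
  let ?G = "g c ?x"
  have x: "?x \<in> cimg c" "open (cimg c)" using A c by (auto simp: cimg_def smooth_atlas_def)
  have G: "transpose ?G = ?G" "invertible ?G"
    using g c x by (auto simp: pseudo_riemannian_metric_def)
  \<comment> \<open>\<open>X\<close> is the connection term in the second covariant derivative at
    \<open>?x\<close> of a function with gradient \<open>\<mu>\<close>.\<close>
  define X where "X = (\<chi> a b. \<Sum>e\<in>UNIV. \<Gamma> c ?x $ e $ a $ b * \<mu> $ e)"
  \<comment> \<open>A function with Hessian \<open>r\<close> times \<open>?G\<close> has Laplacian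
    \<open>r * ?n - gtrace ?G X\<close> at \<open>?x\<close>; this \<open>r\<close> makes the first
    slot of the splitting equal to \<open>\<tau>\<close>.\<close>
  define r where "r = (gtrace ?G X - ?n * \<tau> - conf_J g \<Gamma> c ?x * \<sigma>) / ?n"
  define f where "f = quadratic ?x \<sigma> \<mu> (r *\<^sub>R ?G)"
  define s where "s = (\<lambda>d y. vol_density ?k g d y * f (transition d c y))"
  have rG_sym: "transpose (r *\<^sub>R ?G) = r *\<^sub>R ?G" using G(1) by (simp add: transpose_scalar)
  have "s \<in> densities A ?k p"
    unfolding s_def
  proof (rule density_of_function[OF A g c])
    fix d assume d: "d \<in> A"
    have "open (cdom c)" using A c by (auto simp: smooth_atlas_def)
    then have "open (overlap d c)" using open_coord_image[OF A d] by (simp add: overlap_def)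
    moreover have "smooth_on (transition d c) (overlap d c)"
      using A d c by (auto simp: smooth_atlas_def)
    ultimately show "smooth_on (\<lambda>y. f (transition d c y)) (overlap d c)"
      unfolding f_def by (rule smooth_on_quadratic_compose)
  qed simp
  have triv: "trivialise ?k g s c y = f y" if "y \<in> cimg c" for y
    using vol_density_pos[OF g c(1) that, of ?k] coord_param[OF A c(1) that]
    by (simp add: trivialise_def s_def transition_def flip: vol_density_def)
  \<comment> \<open>Equality is needed throughout \<open>cimg c\<close>, not just at
    \<open>?x\<close>, because it is differentiated once more for \<open>pd2\<close>.\<close>
  have pd1: "pd a (trivialise ?k g s c) y = pd a f y" if "y \<in> cimg c" for a y
    using pd_cong_open[OF x(2) that triv] .
  have pd2: "pd a (pd b (trivialise ?k g s c)) ?x = r * ?G $ a $ b" for a b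
  proof -
    have "pd a (pd b (trivialise ?k g s c)) ?x = pd a (pd b f) ?x"
      using pd_cong_open[OF x(2,1) pd1] .
    also have "\<dots> = (r *\<^sub>R ?G) $ b $ a" unfolding f_def using rG_sym by (rule pd_pd_quadratic)
    also have "\<dots> = r * ?G $ a $ b" using arg_cong[OF G(1), of "\<lambda>M. M $ b $ a"]
      by (simp add: transpose_def)
    finally show ?thesis .
  qed
  have f0: "f ?x = \<sigma>" by (simp add: f_def quadratic_def)
  have f1: "pd a f ?x = \<mu> $ a" for a using pd_quadratic[OF rG_sym] by (simp add: f_def)
  have "gtrace ?G (\<chi> a b. r * ?G $ a $ b - (\<Sum>e\<in>UNIV. \<Gamma> c ?x $ e $ a $ b * \<mu> $ e)) =
      gtrace ?G (r *\<^sub>R ?G - X)"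
    by (rule arg_cong[of _ _ "gtrace ?G"]) (simp add: vec_eq_iff X_def)
  also have "\<dots> = r * ?n - gtrace ?G X"
    by (simp add: gtrace_scaleR gtrace_self[OF G] flip: gtrace_diff)
  finally have tr: "gtrace ?G (\<chi> a b. r * ?G $ a $ b
      - (\<Sum>e\<in>UNIV. \<Gamma> c ?x $ e $ a $ b * \<mu> $ e)) = r * ?n - gtrace ?G X" .
  have "- (r * ?n - gtrace ?G X + conf_J g \<Gamma> c ?x * \<sigma>) / ?n = \<tau>"
    by (simp add: r_def)
  then have "conf_split_density g \<Gamma> c p s = (\<tau>, \<mu>, \<sigma>)"
    unfolding conf_split_density_def Let_def pd1[OF x(1)] pd2 triv[OF x(1)] f0 f1 tr
    by simp
  then show ?thesis
    using conf_split_class[OF A g c \<open>s \<in> densities A ?k p\<close>, of \<Gamma>] by (metis image_eqI)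
qed

section \<open>The pullback identity for the tractor metrics\<close>

theorem proposition8p7:
  fixes A :: "('m::{t2_space, second_countable_topology}, 'n::finite) chart set"
    and g :: "('m, 'n) chart \<Rightarrow> real^'n \<Rightarrow> real^'n^'n"
    and \<Gamma> :: "('m, 'n) chart \<Rightarrow> real^'n \<Rightarrow> real^'n^'n^'n"
    and lam :: real
  assumes "CARD('n) \<ge> 3"
    and "smooth_atlas A"
    and "pseudo_riemannian_metric A g"
    and "levi_civita A g \<Gamma>"
    and "einstein A g \<Gamma>"
    and "\<forall>c\<in>A. \<forall>x\<in>cimg c. proj_schouten \<Gamma> c x = lam *\<^sub>R g c x"
  shows "\<forall>p. \<forall>c\<in>A. p \<in> cdom c \<longrightarrow>
    (\<forall>U \<in> proj_cotractors A p. \<forall>U' \<in> proj_cotractors A p.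
       proj_tractor_metric g lam c p U U' =
       conf_tractor_metric g \<Gamma> c p
         (cotractor_inclusion A g \<Gamma> c p U) (cotractor_inclusion A g \<Gamma> c p U'))"
proof (intro allI ballI impI)
  fix p c U U' assume c: "c \<in> A" "p \<in> cdom c"
  let ?n = "real CARD('n)" and ?x = "coord c p"
  have x: "?x \<in> cimg c" using c by (simp add: cimg_def)
  have J: "conf_J g \<Gamma> c ?x = ?n * lam / 2"
    using assms(1,3,6) c x by (intro conf_J_eq) (auto simp: pseudo_riemannian_metric_def)
  \<comment> \<open>Applying the splitting to the chosen preimage recovers the triple, and the value
    of \<open>conf_J\<close> turns the factor in its first slot into \<open>lam / 2\<close>.\<close>
  have split: "conf_split g \<Gamma> c p (cotractor_inclusion A g \<Gamma> c p U) =
      (lam / 2 * snd (proj_split g c p U), fst (proj_split g c p U), snd (proj_split g c p U))" for U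
    unfolding cotractor_inclusion_def case_prod_beta Let_def
      f_inv_into_f[OF conf_split_surj[OF assms(2,3) c]]
    by (simp add: J)
  show "proj_tractor_metric g lam c p U U' =
      conf_tractor_metric g \<Gamma> c p
        (cotractor_inclusion A g \<Gamma> c p U) (cotractor_inclusion A g \<Gamma> c p U')"
    by (simp add: proj_tractor_metric_def conf_tractor_metric_def split case_prod_beta algebra_simps)
qed

end
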